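(* If $G$ is a $3$-edge-connected graph with $n$ vertices, then $G$ has at least $2^{n/7}$ nowhere-zero $\mathbb{Z}_2\times \mathbb{Z}_3$-flows.
   Context: Graphs are finite and may have loops and parallel edges. Given an orientation of the edges of $G$ and an abelian group $\Gamma$, a $\Gamma$-flow is a map $\phi:E(G)\to\Gamma$ such that for every vertex $v$, $\sum_{e\in\delta^+(v)}\phi(e)=\sum_{e\in\delta^-(v)}\phi(e)$, where $\delta^+(v)$, $\delta^-(v)$ are the sets of edges directed away from / towards $v$. It is nowhere-zero if $\phi(e)\neq 0$ for all edges $e$. (The number of nowhere-zero $\Gamma$-flows does not depend on the chosen orientation, since reversing an edge and negating its value preserves the flow condition.) *)

theory Defs
  imports
    Complex_Main
    "HOL-Library.FuncSet"
    "HOL-Library.Numeral_Type"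
    "HOL-Library.Product_Plus"
    "Graph_Theory.Digraph_Component"
begin

text \<open>
  A finite graph, possibly with loops and parallel edges, together with an orientation of its
  edges is the same thing as an \<^const>\<open>fin_digraph\<close>: the arcs are the edges and
  \<^const>\<open>tail\<close> and \<^const>\<open>head\<close> give the orientation.  A loop at \<open>v\<close> lies both in
  \<^term>\<open>out_arcs G v\<close> and in \<^term>\<open>in_arcs G v\<close>.
\<close>

definition del_arcs :: "('a, 'b) pre_digraph \<Rightarrow> 'b set \<Rightarrow> ('a, 'b) pre_digraph" where
  "del_arcs G F = G\<lparr>arcs := arcs G - F\<rparr>"

text \<open>
  \<^const>\<open>Digraph_Component.connected\<close> is connectedness of the underlying undirected graph, so
  edge-connectivity does not depend on the orientation.  As usual, a graph with only one vertex
  is not \<open>k\<close>-edge-connected for any \<open>k\<close>.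
\<close>

definition edge_connected :: "nat \<Rightarrow> ('a, 'b) pre_digraph \<Rightarrow> bool" where
  "edge_connected k G \<longleftrightarrow>
     card (verts G) > 1 \<and>
     (\<forall>F \<subseteq> arcs G. finite F \<and> card F < k \<longrightarrow> Digraph_Component.connected (del_arcs G F))"

text \<open>
  Flows are maps on the edge set only; they are represented by functions that are
  \<^const>\<open>undefined\<close> off \<^term>\<open>arcs G\<close>, so that each flow is counted once.
\<close>

definition flows :: "('a, 'b) pre_digraph \<Rightarrow> ('b \<Rightarrow> 'g :: ab_group_add) set" where
  "flows G = {\<phi> \<in> arcs G \<rightarrow>\<^sub>E UNIV.
     \<forall>v \<in> verts G. (\<Sum>e \<in> out_arcs G v. \<phi> e) = (\<Sum>e \<in> in_arcs G v. \<phi> e)}"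

definition nowhere_zero_flows :: "('a, 'b) pre_digraph \<Rightarrow> ('b \<Rightarrow> 'g :: ab_group_add) set" where
  "nowhere_zero_flows G = {\<phi> \<in> flows G. \<forall>e \<in> arcs G. \<phi> e \<noteq> 0}"

text \<open>
  The types \<^typ>\<open>2\<close> and \<^typ>\<open>3\<close> are the integers modulo 2 and modulo 3, and the group structure
  on \<^typ>\<open>2 \<times> 3\<close> is the componentwise one.
\<close>

end

theory Submission
  imports Defs
begin

text \<open>
  As in Seymour's 6-flow theorem, there are an integer flow \<open>\<psi>\<close> with values in \<open>{-1, 0, 1}\<close> and
  support \<open>X\<close>, and a \<open>\<int>\<^sub>3\<close>-flow \<open>\<phi>\<close> that is nonzero off \<open>X\<close>.  Each arc of \<open>X\<close> is a zero of exactly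
  one of the flows \<open>\<phi> + j \<psi>\<close>, \<open>j \<in> \<int>\<^sub>3\<close>, so \<open>\<phi>\<close> can be chosen with a zero set \<open>Z\<close> of size at most
  \<open>|X| / 3\<close>.  Keep this \<open>\<phi>\<close>; it can be paired with every \<open>\<int>\<^sub>2\<close>-flow that is 1 on \<open>Z\<close>.  The reduction
  of \<open>\<psi>\<close> modulo 2 is one of these, hence there are at least \<open>2 ^ (|E| - |Z| - (n - 1))\<close> of them.  Each
  vertex has degree at least 3 in \<open>G\<close> and even degree in \<open>X\<close>, which gives \<open>|E| - |X| / 3 \<ge> 7 n / 6\<close>
  and so an exponent of at least \<open>n / 6\<close>.

  To find \<open>\<psi>\<close> and \<open>\<phi>\<close>, grow a vertex set \<open>U\<close> for which the claim holds with arbitrary prescribed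
  net outflows of \<open>\<phi>\<close>.  A minimal set \<open>A\<close> outside \<open>U\<close> that sends at most one arc to the rest of the
  complement of \<open>U\<close> is 2-edge-connected and sends at least two arcs to \<open>U\<close>.  Two arc-disjoint paths
  in \<open>A\<close> between the ends of two of these arcs form the new part of \<open>\<psi>\<close>, and the two arcs leave
  enough freedom to adjust \<open>\<phi>\<close> without zeros.
\<close>

section \<open>Arithmetic modulo 3\<close>

lemma three_cases: "x = 0 \<or> x = 1 \<or> x = 2" for x :: 3
proof -
  have "card {0, 1, 2 :: 3} = card (UNIV :: 3 set)"
    by simp
  then have "{0, 1, 2 :: 3} = UNIV"
    by (intro card_subset_eq) auto
  then show ?thesis
    by auto
qed

text \<open>The signs are their own inverses and can be absorbed into \<open>a\<close> and
  \<open>b\<close>. What remains is that every residue is a sum of two nonzero ones: 0 = 1 + 2, 1 =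
  2 + 2, 2 = 1 + 1.\<close>

lemma nonzero_pair_solution:
  fixes d :: 3
  assumes "s \<in> {1, -1}" "t \<in> {1, -1}"
  shows "\<exists>a b. a \<noteq> 0 \<and> b \<noteq> 0 \<and> s * a + t * b = d"
proof -
  have s: "s * s = 1" and t: "t * t = 1"
    using assms by auto
  consider "d = 0" | "d = 1" | "d = 2"
    using three_cases by blast
  then obtain a b :: 3 where ab: "a \<noteq> 0" "b \<noteq> 0" "a + b = d"
  proof cases
    case 1
    then show ?thesis using that[of 1 2] by simp
  next
    case 2
    then show ?thesis using that[of 2 2] by simp
  next
    case 3
    then show ?thesis using that[of 1 1] by simp
  qed
  have "s * (s * a) + t * (t * b) = d"
    using ab(3) s t by (simp flip: mult.assoc)
  moreover have "s * a \<noteq> 0" "t * b \<noteq> 0"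
    using assms ab by auto
  ultimately show ?thesis
    by blast
qed

context fin_digraph
begin

subsection \<open>Net outflow\<close>

definition net_out :: "('b \<Rightarrow> 'g :: ab_group_add) \<Rightarrow> 'a \<Rightarrow> 'g" where
  "net_out f v = (\<Sum>e \<in> out_arcs G v. f e) - (\<Sum>e \<in> in_arcs G v. f e)"

definition arcs_within :: "'a set \<Rightarrow> 'b set" where
  "arcs_within S = {e \<in> arcs G. tail G e \<in> S \<and> head G e \<in> S}"

definition arcs_between :: "'a set \<Rightarrow> 'a set \<Rightarrow> 'b set" where
  "arcs_between S T =
     {e \<in> arcs G. tail G e \<in> S \<and> head G e \<in> T \<or> tail G e \<in> T \<and> head G e \<in> S}"

lemma finite_arcs_between [simp]: "finite (arcs_between S T)"
  by (rule finite_subset[OF _ finite_arcs]) (auto simp: arcs_between_def)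

text \<open>Group the arcs by tail for the outflow and by head for the inflow. In this form an arc
  with both ends in \<open>S\<close> visibly cancels, so only arcs crossing the boundary of
  \<open>S\<close> count.\<close>

lemma sum_net_out:
  assumes "finite S"
  shows "(\<Sum>v \<in> S. net_out f v) =
    (\<Sum>e \<in> arcs G. (if tail G e \<in> S then f e else 0) - (if head G e \<in> S then f e else 0))"
proof -
  have "(\<Sum>v \<in> S. \<Sum>e \<in> {e \<in> {e \<in> arcs G. g e \<in> S}. g e = v}. f e) = (\<Sum>e \<in> {e \<in> arcs G. g e \<in> S}. f e)"
    for g :: "'b \<Rightarrow> 'a"
    by (rule sum.group) (use assms in auto)
  moreover have "{e \<in> {e \<in> arcs G. g e \<in> S}. g e = v} = {e \<in> arcs G. g e = v}" if "v \<in> S" for g :: "'b \<Rightarrow> 'a" and v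
    using that by auto
  moreover have "(\<Sum>e \<in> {e \<in> arcs G. g e \<in> S}. f e) = (\<Sum>e \<in> arcs G. if g e \<in> S then f e else 0)"
    for g :: "'b \<Rightarrow> 'a"
    by (rule sum.inter_filter) simp
  ultimately show ?thesis
    by (simp add: net_out_def sum_subtractf out_arcs_def in_arcs_def)
qed

lemma net_out_eq:
  "net_out f v =
    (\<Sum>e \<in> arcs G. (if tail G e = v then f e else 0) - (if head G e = v then f e else 0))"
  using sum_net_out[of "{v}" f] by simp

lemma sum_net_out_verts: "(\<Sum>v \<in> verts G. net_out f v) = 0"
  by (simp add: sum_net_out)

lemma net_out_add: "net_out (\<lambda>e. f e + g e) v = net_out f v + net_out g v"
  by (simp add: net_out_def sum.distrib)

lemma net_out_diff: "net_out (\<lambda>e. f e - g e) v = net_out f v - net_out g v"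
  by (simp add: net_out_def sum_subtractf)

lemma net_out_cmult: "net_out (\<lambda>e. c * f e) v = c * net_out f v" for c :: "'c :: comm_ring_1"
  by (simp add: net_out_def sum_distrib_left right_diff_distrib)

lemma net_out_sum: "net_out (\<lambda>e. \<Sum>i \<in> I. f i e) v = (\<Sum>i \<in> I. net_out (f i) v)"
proof -
  have "(\<Sum>e \<in> A. \<Sum>i \<in> I. f i e) = (\<Sum>i \<in> I. \<Sum>e \<in> A. f i e)" for A
    by (rule sum.swap)
  then show ?thesis
    by (simp add: net_out_def sum_subtractf)
qed

lemma net_out_of_int: "net_out (\<lambda>e. of_int (f e)) v = of_int (net_out f v)"
  by (simp add: net_out_def)

lemma net_out_zero [simp]: "net_out (\<lambda>e. 0) v = 0"
  by (simp add: net_out_def)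

lemma net_out_unit:
  assumes "e \<in> arcs G"
  shows "net_out (\<lambda>e'. if e' = e then s else 0) v =
    (if v = tail G e then s else 0) - (if v = head G e then s else 0)"
proof -
  have "net_out (\<lambda>e'. if e' = e then s else 0) v =
    (\<Sum>e' \<in> arcs G. if e' = e then (if v = tail G e then s else 0) - (if v = head G e then s else 0) else 0)"
    unfolding net_out_eq by (rule sum.cong) auto
  also have "\<dots> = (if v = tail G e then s else 0) - (if v = head G e then s else 0)"
    using assms by (subst sum.delta) auto
  finally show ?thesis .
qed

lemma net_out_eq_0:
  assumes "\<And>e. e \<in> arcs G \<Longrightarrow> f e \<noteq> 0 \<Longrightarrow> tail G e \<in> S \<and> head G e \<in> S" and "v \<notin> S"
  shows "net_out f v = 0"
  unfolding net_out_eq by (rule sum.neutral) (use assms in auto)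

lemma sum_net_out_closed:
  assumes "finite S" and "\<And>e. e \<in> arcs G \<Longrightarrow> f e \<noteq> 0 \<Longrightarrow> tail G e \<in> S \<longleftrightarrow> head G e \<in> S"
  shows "(\<Sum>v \<in> S. net_out f v) = 0"
  unfolding sum_net_out[OF assms(1)] by (rule sum.neutral) (use assms in auto)

lemma net_out_restrict:
  assumes "\<And>e. e \<in> arcs G \<Longrightarrow> f e \<noteq> 0 \<Longrightarrow> tail G e \<in> S \<longleftrightarrow> head G e \<in> S"
  shows "net_out (\<lambda>e. if e \<in> arcs_within S then f e else 0) v = (if v \<in> S then net_out f v else 0)"
proof (cases "v \<in> S")
  case True
  then have "net_out (\<lambda>e. if e \<in> arcs_within S then f e else 0) v = net_out f v"
    unfolding net_out_eq by (intro sum.cong) (use assms in \<open>auto simp: arcs_within_def\<close>)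
  then show ?thesis
    using True by simp
next
  case False
  then show ?thesis
    by (simp, intro net_out_eq_0[where S = S]) (auto simp: arcs_within_def split: if_splits)
qed

section \<open>Unit flows between two vertices\<close>

text \<open>The net outflow of a unit flow from \<open>x\<close> to \<open>y\<close>. It vanishes
  identically for \<open>x = y\<close>, so the zero flow joins \<open>x\<close> to itself.\<close>

definition from_to :: "'a \<Rightarrow> 'a \<Rightarrow> 'a \<Rightarrow> int" where
  "from_to x y v = (if v = x then 1 else 0) - (if v = y then 1 else 0)"

text \<open>
  \<open>ok e 1\<close> and \<open>ok e (-1)\<close> say that \<open>e\<close> may be used forwards and backwards, respectively.  In a largest
  set \<open>R\<close> of vertices reachable by such flows inside \<open>R\<close>, a usable arc leaving \<open>R\<close> is not yet in use,
  so no simple paths are needed.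
\<close>

lemma unit_flow_exists:
  fixes ok :: "'b \<Rightarrow> int \<Rightarrow> bool"
  assumes "A \<subseteq> verts G" "x \<in> A" "y \<in> A"
    and step: "\<And>R. R \<subseteq> A \<Longrightarrow> x \<in> R \<Longrightarrow> y \<notin> R \<Longrightarrow>
      \<exists>e \<in> arcs G. ok e 1 \<and> tail G e \<in> R \<and> head G e \<in> A - R \<or>
                  ok e (-1) \<and> head G e \<in> R \<and> tail G e \<in> A - R"
  obtains q where "\<And>e. q e \<noteq> 0 \<Longrightarrow> e \<in> arcs_within A \<and> \<bar>q e\<bar> = 1 \<and> ok e (q e)"
    and "\<And>v. net_out q v = from_to x y v"
proof -
  define ex where "ex R v \<longleftrightarrow> (\<exists>q. (\<forall>e. q e \<noteq> 0 \<longrightarrow> e \<in> arcs_within R \<and> \<bar>q e\<bar> = 1 \<and> ok e (q e)) \<and>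
    (\<forall>w. net_out q w = from_to x v w))" for R v
  define good where "good R \<longleftrightarrow> R \<subseteq> A \<and> x \<in> R \<and> (\<forall>v \<in> R. ex R v)" for R
  have ex_mono: "ex R' v" if "ex R v" "R \<subseteq> R'" for R R' v
  proof -
    have "arcs_within R \<subseteq> arcs_within R'"
      using that(2) by (auto simp: arcs_within_def)
    then show ?thesis
      using that(1) unfolding ex_def by blast
  qed
  have "ex {x} x"
    unfolding ex_def by (rule exI[of _ "\<lambda>_. 0"]) (simp add: from_to_def)
  then have "good {x}"
    using assms by (auto simp: good_def)
  have fin: "finite A"
    using assms(1) finite_verts finite_subset by blast
  have "\<exists>R. good R \<and> (\<forall>R'. good R' \<longrightarrow> card R' \<le> card R)"
    by (rule ex_has_greatest_nat[of good, OF \<open>good {x}\<close>, of card "card A + 1"])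
      (use fin in \<open>auto simp: good_def card_mono le_imp_less_Suc\<close>)
  then obtain R where R: "good R" and max: "\<And>R'. good R' \<Longrightarrow> card R' \<le> card R"
    by blast
  have "y \<in> R"
  proof (rule ccontr)
    assume "y \<notin> R"
    have "\<exists>e \<in> arcs G. ok e 1 \<and> tail G e \<in> R \<and> head G e \<in> A - R \<or>
                  ok e (-1) \<and> head G e \<in> R \<and> tail G e \<in> A - R"
      using R \<open>y \<notin> R\<close> by (intro step) (auto simp: good_def)
    \<comment> \<open>\<open>s\<close> is the value to be put on \<open>e\<close>, and
      \<open>u\<close>, \<open>w\<close> are its ends in the direction of travel; forward and
      backward use can then be treated together.\<close>
    then obtain e s u w where e: "e \<in> arcs G" "ok e s" "s \<in> {1, -1}" "u \<in> R" "w \<in> A - R"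
      and uw: "s = 1 \<and> u = tail G e \<and> w = head G e \<or> s = -1 \<and> u = head G e \<and> w = tail G e"
      by blast
    have "ex R u"
      using R \<open>u \<in> R\<close> by (auto simp: good_def)
    then obtain q where q: "\<And>e. q e \<noteq> 0 \<Longrightarrow> e \<in> arcs_within R \<and> \<bar>q e\<bar> = 1 \<and> ok e (q e)"
      "\<And>w. net_out q w = from_to x u w"
      unfolding ex_def by blast
    have e_notin: "e \<notin> arcs_within R"
      using uw e by (auto simp: arcs_within_def)
    then have "q e = 0"
      using q(1) by blast
    let ?q = "\<lambda>e'. q e' + (if e' = e then s else 0)"
    have "ex (insert w R) w"
      unfolding ex_def
    proof (intro exI[of _ ?q] conjI allI impI)
      fix e' assume "?q e' \<noteq> 0"
      then show "e' \<in> arcs_within (insert w R)" "\<bar>?q e'\<bar> = 1" "ok e' (?q e')"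
        using q(1)[of e'] e uw \<open>q e = 0\<close> by (auto simp: arcs_within_def split: if_splits)
    next
      fix v show "net_out ?q v = from_to x w v"
        unfolding net_out_add q(2) net_out_unit[OF e(1)] using uw by (auto simp: from_to_def)
    qed
    then have "good (insert w R)"
      using R e ex_mono[of R _ "insert w R"] by (auto simp: good_def)
    from max[OF this] have "card (insert w R) \<le> card R" .
    moreover have "finite R"
      using R fin finite_subset by (auto simp: good_def)
    ultimately show False
      using e by (simp add: card_insert_if)
  qed
  then have "ex R y"
    using R by (auto simp: good_def)
  then have "ex A y"
    using R ex_mono by (auto simp: good_def)
  then show ?thesis
    using that unfolding ex_def by blast
qed

subsection \<open>Seymour's pair of flows\<close>

text \<open>Arbitrary demands \<open>b\<close> are needed for induction: when two sets are joined,
  the arcs between them change what each side has to supply. Demands must sum to 0 because arcs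
  within \<open>U\<close> contribute 0 in total. Functions are 0, not \<open>undefined\<close>,
  elsewhere, so that they can be added.\<close>

definition nice :: "'a set \<Rightarrow> ('b \<Rightarrow> int) \<Rightarrow> bool" where
  "nice U \<psi> \<longleftrightarrow> U \<subseteq> verts G \<and>
    (\<forall>e. \<psi> e \<noteq> 0 \<longrightarrow> e \<in> arcs_within U \<and> \<bar>\<psi> e\<bar> = 1) \<and> (\<forall>v. net_out \<psi> v = 0) \<and>
    (\<forall>b :: 'a \<Rightarrow> 3. (\<Sum>v \<in> U. b v) = 0 \<longrightarrow>
      (\<exists>\<phi>. (\<forall>e. \<phi> e \<noteq> 0 \<longrightarrow> e \<in> arcs_within U) \<and> (\<forall>v \<in> U. net_out \<phi> v = b v) \<and>
        (\<forall>e \<in> arcs_within U. \<psi> e = 0 \<longrightarrow> \<phi> e \<noteq> 0)))"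

lemma niceD:
  assumes "nice U \<psi>"
  shows "U \<subseteq> verts G" "\<psi> e \<noteq> 0 \<Longrightarrow> e \<in> arcs_within U \<and> \<bar>\<psi> e\<bar> = 1" "net_out \<psi> v = 0"
  using assms unfolding nice_def by simp_all

lemma nice_realize:
  fixes b :: "'a \<Rightarrow> 3"
  assumes "nice U \<psi>" "(\<Sum>v \<in> U. b v) = 0"
  obtains \<phi> where "\<And>e. \<phi> e \<noteq> 0 \<Longrightarrow> e \<in> arcs_within U" "\<And>v. v \<in> U \<Longrightarrow> net_out \<phi> v = b v"
    "\<And>e. e \<in> arcs_within U \<Longrightarrow> \<psi> e = 0 \<Longrightarrow> \<phi> e \<noteq> 0"
proof -
  have "\<exists>\<phi>. (\<forall>e. \<phi> e \<noteq> 0 \<longrightarrow> e \<in> arcs_within U) \<and> (\<forall>v \<in> U. net_out \<phi> v = b v) \<and>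
        (\<forall>e \<in> arcs_within U. \<psi> e = 0 \<longrightarrow> \<phi> e \<noteq> 0)"
    using assms unfolding nice_def by simp
  then show ?thesis
    using that by blast
qed

text \<open>Put 1 on all arcs off the support of \<open>\<psi>\<close>, then repair the net outflows
  using arcs of the support only, where zeros are allowed. Each vertex exchanges its remaining
  demand with \<open>x\<close> along the support.\<close>

lemma nice_if_connected_support:
  assumes "U \<subseteq> verts G" "x \<in> U"
    and \<psi>: "\<And>e. \<psi> e \<noteq> 0 \<Longrightarrow> e \<in> arcs_within U \<and> \<bar>\<psi> e\<bar> = 1" "\<And>v. net_out \<psi> v = 0"
    and conn: "\<And>v. v \<in> U \<Longrightarrow> \<exists>q. (\<forall>e. q e \<noteq> 0 \<longrightarrow> \<psi> e \<noteq> 0) \<and> (\<forall>w. net_out q w = from_to x v w)"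
  shows "nice U \<psi>"
  unfolding nice_def
proof (intro conjI allI impI)
  fix b :: "'a \<Rightarrow> 3" assume b: "(\<Sum>v \<in> U. b v) = 0"
  have fin: "finite U"
    using assms(1) finite_verts finite_subset by blast
  define \<phi>\<^sub>0 :: "'b \<Rightarrow> 3" where "\<phi>\<^sub>0 e = (if e \<in> arcs_within U \<and> \<psi> e = 0 then 1 else 0)" for e
  define c where "c v = b v - net_out \<phi>\<^sub>0 v" for v
  obtain q where q: "\<And>v e. v \<in> U \<Longrightarrow> q v e \<noteq> 0 \<Longrightarrow> \<psi> e \<noteq> 0"
    "\<And>v w. v \<in> U \<Longrightarrow> net_out (q v) w = from_to x v w"
    using conn by metis
  \<comment> \<open>\<open>q v\<close> has net outflow -1 at \<open>v\<close>, hence the minus sign.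
    What accumulates at \<open>x\<close> is the sum of all \<open>c v\<close>, which is 0.\<close>
  define \<phi>\<^sub>1 :: "'b \<Rightarrow> 3" where "\<phi>\<^sub>1 e = (\<Sum>v \<in> U. - c v * of_int (q v e))" for e
  have \<phi>\<^sub>1_0: "\<phi>\<^sub>1 e = 0" if "\<psi> e = 0" for e
    unfolding \<phi>\<^sub>1_def by (rule sum.neutral) (use q that in force)
  have "(\<Sum>v \<in> U. net_out \<phi>\<^sub>0 v) = 0"
    by (rule sum_net_out_closed[OF fin]) (auto simp: \<phi>\<^sub>0_def arcs_within_def split: if_splits)
  then have c: "(\<Sum>v \<in> U. c v) = 0"
    using b by (simp add: c_def sum_subtractf)
  have \<phi>\<^sub>1: "net_out \<phi>\<^sub>1 w = c w" if "w \<in> U" for w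
  proof -
    have "net_out \<phi>\<^sub>1 w = (\<Sum>v \<in> U. - c v * of_int (from_to x v w))"
      unfolding \<phi>\<^sub>1_def[abs_def] net_out_sum net_out_cmult net_out_of_int
      by (rule sum.cong) (simp_all add: q)
    also have "\<dots> = (\<Sum>v \<in> U. (if w = v then c v else 0) - (if w = x then c v else 0))"
      by (rule sum.cong) (auto simp: from_to_def)
    also have "\<dots> = c w - (if w = x then \<Sum>v \<in> U. c v else 0)"
      using fin that by (simp add: sum_subtractf sum.delta')
    finally show ?thesis
      using c by simp
  qed
  show "\<exists>\<phi>. (\<forall>e. \<phi> e \<noteq> 0 \<longrightarrow> e \<in> arcs_within U) \<and> (\<forall>v \<in> U. net_out \<phi> v = b v) \<and>
        (\<forall>e \<in> arcs_within U. \<psi> e = 0 \<longrightarrow> \<phi> e \<noteq> 0)"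
  proof (intro exI[of _ "\<lambda>e. \<phi>\<^sub>0 e + \<phi>\<^sub>1 e"] conjI ballI allI impI)
    show "net_out (\<lambda>e. \<phi>\<^sub>0 e + \<phi>\<^sub>1 e) v = b v" if "v \<in> U" for v
      using \<phi>\<^sub>1[OF that] by (simp add: net_out_add c_def)
  qed (use \<phi>\<^sub>1_0 \<psi>(1) in \<open>auto simp: \<phi>\<^sub>0_def split: if_splits\<close>)
qed (use assms in auto)

lemma nice_singleton:
  assumes "x \<in> verts G"
  shows "nice {x} (\<lambda>_. 0)"
  by (rule nice_if_connected_support[of _ x]) (use assms in \<open>auto simp: from_to_def intro!: exI[of _ "\<lambda>_. 0"]\<close>)

section \<open>Joining two disjoint sets by at least two arcs\<close>

text \<open>All arcs but two get the value 1; the two remaining nonzero values can be chosen to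
  reach any prescribed total.\<close>

lemma nowhere_zero_on_arcs_between:
  fixes d :: 3
  assumes disj: "U \<inter> W = {}" and fin: "finite W" and two: "card (arcs_between U W) \<ge> 2"
  obtains c where "\<And>e. c e \<noteq> 0 \<longleftrightarrow> e \<in> arcs_between U W" "(\<Sum>v \<in> W. net_out c v) = d"
proof -
  let ?B = "arcs_between U W"
  \<comment> \<open>The sign with which an arc between \<open>U\<close> and \<open>W\<close> enters
    the net outflow of \<open>W\<close>.\<close>
  define s :: "'b \<Rightarrow> 3" where "s e = (if tail G e \<in> W then 1 else -1)" for e
  obtain f where f: "f \<in> ?B"
    using two by (metis card.empty ex_in_conv not_numeral_le_zero)
  have "card (?B - {f}) \<noteq> 0"
    using two f by simp
  then obtain g where g: "g \<in> ?B - {f}"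
    by (metis card.empty ex_in_conv)
  have sums: "(\<Sum>v \<in> W. net_out c v) = (\<Sum>e \<in> ?B. s e * c e)" if "\<And>e. e \<notin> ?B \<Longrightarrow> c e = 0" for c
  proof -
    have "(\<Sum>v \<in> W. net_out c v) = (\<Sum>e \<in> arcs G. if e \<in> ?B then s e * c e else 0)"
      unfolding sum_net_out[OF fin]
      by (rule sum.cong) (use disj that in \<open>auto simp: s_def arcs_between_def\<close>)
    also have "\<dots> = (\<Sum>e \<in> {e \<in> arcs G. e \<in> ?B}. s e * c e)"
      by (rule sum.inter_filter[symmetric]) simp
    also have "{e \<in> arcs G. e \<in> ?B} = ?B"
      by (auto simp: arcs_between_def)
    finally show ?thesis .
  qed
  have "s f \<in> {1, -1}" "s g \<in> {1, -1}"
    by (auto simp: s_def)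
  then obtain a b where ab: "a \<noteq> 0" "b \<noteq> 0" "s f * a + s g * b = d - (\<Sum>e \<in> ?B - {f} - {g}. s e)"
    using nonzero_pair_solution by metis
  define c where "c e = (if e = f then a else if e = g then b else if e \<in> ?B then 1 else 0)" for e
  have "(\<Sum>e \<in> ?B. s e * c e) = s f * c f + (s g * c g + (\<Sum>e \<in> ?B - {f} - {g}. s e * c e))"
    using f g by (simp add: sum.remove[of ?B f] sum.remove[of "?B - {f}" g])
  also have "(\<Sum>e \<in> ?B - {f} - {g}. s e * c e) = (\<Sum>e \<in> ?B - {f} - {g}. s e)"
    by (rule sum.cong) (auto simp: c_def)
  also have "s f * c f + (s g * c g + \<dots>) = d"
    using ab g by (simp add: c_def algebra_simps)
  finally have "(\<Sum>v \<in> W. net_out c v) = d"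
    using f g by (subst sums) (auto simp: c_def)
  moreover have "c e \<noteq> 0 \<longleftrightarrow> e \<in> ?B" for e
    using f g ab by (auto simp: c_def)
  ultimately show ?thesis
    using that by blast
qed

lemma arcs_within_Un: "arcs_within (U \<union> W) = arcs_within U \<union> arcs_within W \<union> arcs_between U W"
  by (auto simp: arcs_within_def arcs_between_def)

text \<open>Fix nonzero values on the arcs between the sets so that the total demand left on
  \<open>W\<close> is 0; since \<open>b\<close> sums to 0, the same then holds on \<open>U\<close>.
  Both remainders are realized separately, on disjoint sets of arcs, so no new zeros arise.\<close>

lemma nice_merge:
  assumes U: "nice U \<psi>\<^sub>1" and W: "nice W \<psi>\<^sub>2" and disj: "U \<inter> W = {}"
    and two: "card (arcs_between U W) \<ge> 2"
  shows "nice (U \<union> W) (\<lambda>e. \<psi>\<^sub>1 e + \<psi>\<^sub>2 e)"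
proof -
  have fin: "finite U" "finite W"
    using niceD(1)[OF U] niceD(1)[OF W] finite_verts finite_subset by blast+
  have disj_arcs: "arcs_within U \<inter> arcs_within W = {}" "arcs_within U \<inter> arcs_between U W = {}"
    "arcs_within W \<inter> arcs_between U W = {}"
    using disj by (auto simp: arcs_within_def arcs_between_def)
  have \<psi>\<^sub>1: "\<psi>\<^sub>1 e \<noteq> 0 \<Longrightarrow> e \<in> arcs_within U \<and> \<bar>\<psi>\<^sub>1 e\<bar> = 1" "net_out \<psi>\<^sub>1 v = 0"
    and \<psi>\<^sub>2: "\<psi>\<^sub>2 e \<noteq> 0 \<Longrightarrow> e \<in> arcs_within W \<and> \<bar>\<psi>\<^sub>2 e\<bar> = 1" "net_out \<psi>\<^sub>2 v = 0" for e v
    by (rule niceD[OF U] niceD[OF W]; assumption)+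
  have "\<exists>\<phi>. (\<forall>e. \<phi> e \<noteq> 0 \<longrightarrow> e \<in> arcs_within (U \<union> W)) \<and> (\<forall>v \<in> U \<union> W. net_out \<phi> v = b v) \<and>
        (\<forall>e \<in> arcs_within (U \<union> W). \<psi>\<^sub>1 e + \<psi>\<^sub>2 e = 0 \<longrightarrow> \<phi> e \<noteq> 0)"
    if b: "(\<Sum>v \<in> U \<union> W. b v) = 0" for b :: "'a \<Rightarrow> 3"
  proof -
    obtain c where c: "\<And>e. c e \<noteq> 0 \<longleftrightarrow> e \<in> arcs_between U W"
      "(\<Sum>v \<in> W. net_out c v) = (\<Sum>v \<in> W. b v)"
      using nowhere_zero_on_arcs_between[OF disj fin(2) two, where d = "\<Sum>v \<in> W. b v"] by blast
    have "(\<Sum>v \<in> U \<union> W. net_out c v) = 0"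
      by (rule sum_net_out_closed) (use fin c(1) in \<open>auto simp: arcs_between_def\<close>)
    then have "(\<Sum>v \<in> U. net_out c v) = (\<Sum>v \<in> U. b v)"
      using b c(2) fin disj by (simp add: sum.union_disjoint) (metis add_right_cancel)
    then have zero: "(\<Sum>v \<in> U. b v - net_out c v) = 0" "(\<Sum>v \<in> W. b v - net_out c v) = 0"
      using c(2) by (simp_all add: sum_subtractf)
    obtain \<phi>\<^sub>1 where
      \<phi>\<^sub>1: "\<And>e. \<phi>\<^sub>1 e \<noteq> 0 \<Longrightarrow> e \<in> arcs_within U" "\<And>v. v \<in> U \<Longrightarrow> net_out \<phi>\<^sub>1 v = b v - net_out c v"
        "\<And>e. e \<in> arcs_within U \<Longrightarrow> \<psi>\<^sub>1 e = 0 \<Longrightarrow> \<phi>\<^sub>1 e \<noteq> 0"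
      using nice_realize[OF U zero(1)] by blast
    obtain \<phi>\<^sub>2 where
      \<phi>\<^sub>2: "\<And>e. \<phi>\<^sub>2 e \<noteq> 0 \<Longrightarrow> e \<in> arcs_within W" "\<And>v. v \<in> W \<Longrightarrow> net_out \<phi>\<^sub>2 v = b v - net_out c v"
        "\<And>e. e \<in> arcs_within W \<Longrightarrow> \<psi>\<^sub>2 e = 0 \<Longrightarrow> \<phi>\<^sub>2 e \<noteq> 0"
      using nice_realize[OF W zero(2)] by blast
    have out: "net_out \<phi>\<^sub>1 v = 0" if "v \<notin> U" for v
      using net_out_eq_0[OF _ that] \<phi>\<^sub>1(1) by (auto simp: arcs_within_def)
    have out': "net_out \<phi>\<^sub>2 v = 0" if "v \<notin> W" for v
      using net_out_eq_0[OF _ that] \<phi>\<^sub>2(1) by (auto simp: arcs_within_def)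
    let ?\<phi> = "\<lambda>e. c e + (\<phi>\<^sub>1 e + \<phi>\<^sub>2 e)"
    show ?thesis
    proof (intro exI[of _ ?\<phi>] conjI allI ballI impI)
      show "e \<in> arcs_within (U \<union> W)" if "?\<phi> e \<noteq> 0" for e
        using that c(1)[of e] \<phi>\<^sub>1(1)[of e] \<phi>\<^sub>2(1)[of e] unfolding arcs_within_Un
        by (cases "c e = 0"; cases "\<phi>\<^sub>1 e = 0") auto
      show "net_out ?\<phi> v = b v" if "v \<in> U \<union> W" for v
      proof -
        have "v \<in> U \<and> v \<notin> W \<or> v \<in> W \<and> v \<notin> U"
          using that disj by blast
        then show ?thesis
          by (elim disjE conjE) (simp_all add: net_out_add \<phi>\<^sub>1(2) \<phi>\<^sub>2(2) out out')
      qed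
      show "?\<phi> e \<noteq> 0" if "e \<in> arcs_within (U \<union> W)" "\<psi>\<^sub>1 e + \<psi>\<^sub>2 e = 0" for e
      proof -
        note e = that(1)
        have \<psi>_0: "\<psi>\<^sub>1 e = 0" "\<psi>\<^sub>2 e = 0"
          using that(2) \<psi>\<^sub>1(1)[of e] \<psi>\<^sub>2(1)[of e] disj_arcs(1) by auto
        consider "e \<in> arcs_within U" | "e \<in> arcs_within W" | "e \<in> arcs_between U W"
          using e unfolding arcs_within_Un by blast
        then show ?thesis
        proof cases
          case 1
          then have "c e = 0" "\<phi>\<^sub>2 e = 0" "\<phi>\<^sub>1 e \<noteq> 0"
            using disj_arcs c(1)[of e] \<phi>\<^sub>2(1)[of e] \<phi>\<^sub>1(3)[of e] \<psi>_0 by blast+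
          then show ?thesis by simp
        next
          case 2
          then have "c e = 0" "\<phi>\<^sub>1 e = 0" "\<phi>\<^sub>2 e \<noteq> 0"
            using disj_arcs c(1)[of e] \<phi>\<^sub>1(1)[of e] \<phi>\<^sub>2(3)[of e] \<psi>_0 by blast+
          then show ?thesis by simp
        next
          case 3
          then have "\<phi>\<^sub>1 e = 0" "\<phi>\<^sub>2 e = 0" "c e \<noteq> 0"
            using disj_arcs c(1)[of e] \<phi>\<^sub>1(1)[of e] \<phi>\<^sub>2(1)[of e] by blast+
          then show ?thesis by simp
        qed
      qed
    qed
  qed
  moreover have "e \<in> arcs_within (U \<union> W) \<and> \<bar>\<psi>\<^sub>1 e + \<psi>\<^sub>2 e\<bar> = 1" if "\<psi>\<^sub>1 e + \<psi>\<^sub>2 e \<noteq> 0" for e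
    using that \<psi>\<^sub>1(1)[of e] \<psi>\<^sub>2(1)[of e] disj_arcs(1) unfolding arcs_within_Un
    by (cases "\<psi>\<^sub>1 e = 0"; cases "\<psi>\<^sub>2 e = 0") auto
  moreover have "U \<union> W \<subseteq> verts G"
    using niceD(1)[OF U] niceD(1)[OF W] by blast
  ultimately show ?thesis
    unfolding nice_def[of "U \<union> W"] net_out_add \<psi>\<^sub>1(2) \<psi>\<^sub>2(2) by simp
qed

section \<open>Two arc-disjoint paths and the circulation made of them\<close>

text \<open>The cut condition yields a flow of value 2 from \<open>x\<close> to \<open>y\<close>
  with values in {-1, 0, 1}. Reversing one of its two unit parts gives a circulation with the same
  support, and \<open>K\<close> is the vertex set of the component of this support containing
  \<open>x\<close> and \<open>y\<close>.\<close>

lemma nice_subset_through_two_vertices: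
  assumes A: "A \<subseteq> verts G" and xy: "x \<in> A" "y \<in> A"
    and cut: "\<And>B. B \<subset> A \<Longrightarrow> B \<noteq> {} \<Longrightarrow> card (arcs_between B (A - B)) \<ge> 2"
  obtains K \<psi> where "K \<subseteq> A" "x \<in> K" "y \<in> K" "nice K \<psi>"
proof (cases "x = y")
  \<comment> \<open>This occurs when the two arcs to be attached share their end; a single vertex is
    enough.\<close>
  case True
  then show ?thesis
    using that[of "{x}"] nice_singleton[of x] A xy by auto
next
  case False
  have fin: "finite A"
    using A finite_verts finite_subset by blast
  obtain p where p: "\<And>e. p e \<noteq> 0 \<Longrightarrow> e \<in> arcs_within A \<and> \<bar>p e\<bar> = 1 \<and> True"
    "\<And>v. net_out p v = from_to x y v"
  proof (rule unit_flow_exists[OF A xy, of "\<lambda>_ _. True"])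
    fix R assume R: "R \<subseteq> A" "x \<in> R" "y \<notin> R"
    then have "card (arcs_between R (A - R)) \<ge> 2"
      using xy by (intro cut) auto
    then obtain e where "e \<in> arcs_between R (A - R)"
      by (metis card.empty ex_in_conv not_numeral_le_zero)
    then show "\<exists>e \<in> arcs G. True \<and> tail G e \<in> R \<and> head G e \<in> A - R \<or>
        True \<and> head G e \<in> R \<and> tail G e \<in> A - R"
      by (auto simp: arcs_between_def)
  qed (use that in blast)
  have out_R: "(\<Sum>v \<in> R. net_out f v) = m"
    if "R \<subseteq> A" "x \<in> R" "y \<notin> R" "\<And>v. net_out f v = m * from_to x y v" for f R m
  proof -
    have "finite R"
      using that(1) fin finite_subset by blast
    moreover have "(\<Sum>v \<in> R. net_out f v) = (\<Sum>v \<in> R. if v = x then m else 0)"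
      by (rule sum.cong) (use that in \<open>auto simp: from_to_def\<close>)
    ultimately show ?thesis
      using that(2) by simp
  qed
  \<comment> \<open>The easy half of max-flow min-cut: a flow inside \<open>A\<close> sends out of
    \<open>R\<close> no more than the capacities \<open>g\<close> of the cut allow.\<close>
  have le_out: "(\<Sum>v \<in> R. net_out f v) \<le> (\<Sum>e \<in> arcs_between R (A - R). g e)"
    if "R \<subseteq> A" "\<And>e. f e \<noteq> 0 \<Longrightarrow> e \<in> arcs_within A"
      "\<And>e. e \<in> arcs G \<Longrightarrow> tail G e \<in> R \<Longrightarrow> head G e \<in> A - R \<Longrightarrow> f e \<le> g e"
      "\<And>e. e \<in> arcs G \<Longrightarrow> head G e \<in> R \<Longrightarrow> tail G e \<in> A - R \<Longrightarrow> - f e \<le> g e" for f g :: "'b \<Rightarrow> int" and R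
  proof -
    have "(\<Sum>v \<in> R. net_out f v) \<le> (\<Sum>e \<in> arcs G. if e \<in> arcs_between R (A - R) then g e else 0)"
      unfolding sum_net_out[OF finite_subset[OF that(1) fin]]
    proof (rule sum_mono)
      fix e assume "e \<in> arcs G"
      then show "(if tail G e \<in> R then f e else 0) - (if head G e \<in> R then f e else 0)
          \<le> (if e \<in> arcs_between R (A - R) then g e else 0)"
        using that(2)[of e] that(3)[of e] that(4)[of e]
        by (cases "f e = 0"; cases "tail G e \<in> R"; cases "head G e \<in> R")
          (auto simp: arcs_between_def arcs_within_def)
    qed
    also have "\<dots> = (\<Sum>e \<in> {e \<in> arcs G. e \<in> arcs_between R (A - R)}. g e)"
      by (rule sum.inter_filter[symmetric]) simp
    also have "{e \<in> arcs G. e \<in> arcs_between R (A - R)} = arcs_between R (A - R)"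
      by (auto simp: arcs_between_def)
    finally show ?thesis .
  qed
  txt \<open>\<open>q\<close> augments \<open>p\<close>, so that \<open>h = p + q\<close> has value 2; \<open>r\<close> is one of the two paths in \<open>h\<close>, and
    \<open>2 r - h\<close> is \<open>h\<close> with the other path reversed.\<close>
  obtain q where q: "\<And>e. q e \<noteq> 0 \<Longrightarrow> e \<in> arcs_within A \<and> \<bar>q e\<bar> = 1 \<and> \<bar>p e + q e\<bar> \<le> 1"
    "\<And>v. net_out q v = from_to x y v"
  proof (rule unit_flow_exists[OF A xy, of "\<lambda>e s. \<bar>p e + s\<bar> \<le> 1"])
    fix R assume R: "R \<subseteq> A" "x \<in> R" "y \<notin> R"
    show "\<exists>e \<in> arcs G. \<bar>p e + 1\<bar> \<le> 1 \<and> tail G e \<in> R \<and> head G e \<in> A - R \<or>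
        \<bar>p e + - 1\<bar> \<le> 1 \<and> head G e \<in> R \<and> tail G e \<in> A - R"
    proof (rule ccontr)
      assume contra: "\<not> ?thesis"
      have "p e = 1" if "e \<in> arcs G" "tail G e \<in> R" "head G e \<in> A - R" for e
      proof -
        have "\<not> \<bar>p e + 1\<bar> \<le> 1"
          using contra that by blast
        then show ?thesis
          using p(1)[of e] by (cases "p e = 0") auto
      qed
      moreover have "p e = -1" if "e \<in> arcs G" "head G e \<in> R" "tail G e \<in> A - R" for e
      proof -
        have "\<not> \<bar>p e + - 1\<bar> \<le> 1"
          using contra that by blast
        then show ?thesis
          using p(1)[of e] by (cases "p e = 0") auto
      qed
      \<comment> \<open>A blocked cut is saturated by \<open>p\<close>, which would therefore send
        at least 2 across it although its value is 1. As \<open>le_out\<close> gives upper bounds,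
        it is applied to \<open>- p\<close>.\<close>
      ultimately have "(\<Sum>v \<in> R. net_out (\<lambda>e. - p e) v) \<le> (\<Sum>e \<in> arcs_between R (A - R). - 1)"
        using p(1) by (intro le_out R(1)) auto
      moreover have "(\<Sum>v \<in> R. net_out (\<lambda>e. - p e) v) = - 1"
        by (rule out_R[OF R]) (use p(2) net_out_cmult[of "-1" p] in simp)
      moreover have "card (arcs_between R (A - R)) \<ge> 2"
        using R xy by (intro cut) auto
      ultimately show False
        by simp
    qed
  qed (use that in blast)
  define h where "h e = p e + q e" for e
  have h: "e \<in> arcs_within A \<and> \<bar>h e\<bar> = 1" if "h e \<noteq> 0" for e
    using that p(1)[of e] q(1)[of e] by (cases "p e = 0"; cases "q e = 0") (auto simp: h_def)
  have net_h: "net_out h v = 2 * from_to x y v" for v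
    unfolding h_def[abs_def] net_out_add p q by simp
  obtain r where r: "\<And>e. r e \<noteq> 0 \<Longrightarrow> e \<in> arcs_within A \<and> \<bar>r e\<bar> = 1 \<and> h e = r e"
    "\<And>v. net_out r v = from_to x y v"
  proof (rule unit_flow_exists[OF A xy, of "\<lambda>e s. h e = s"])
    fix R assume R: "R \<subseteq> A" "x \<in> R" "y \<notin> R"
    show "\<exists>e \<in> arcs G. h e = 1 \<and> tail G e \<in> R \<and> head G e \<in> A - R \<or>
        h e = - 1 \<and> head G e \<in> R \<and> tail G e \<in> A - R"
    proof (rule ccontr)
      assume contra: "\<not> ?thesis"
      have "h e \<le> 0" if "e \<in> arcs G" "tail G e \<in> R" "head G e \<in> A - R" for e
      proof -
        have "h e \<noteq> 1"
          using contra that by blast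
        then show ?thesis
          using h[of e] by (cases "h e = 0") auto
      qed
      moreover have "- h e \<le> 0" if "e \<in> arcs G" "head G e \<in> R" "tail G e \<in> A - R" for e
      proof -
        have "h e \<noteq> - 1"
          using contra that by blast
        then show ?thesis
          using h[of e] by (cases "h e = 0") auto
      qed
      \<comment> \<open>Without a usable arc, \<open>h\<close> has no positive contribution across
        the cut, against its value 2.\<close>
      ultimately have "(\<Sum>v \<in> R. net_out h v) \<le> (\<Sum>e \<in> arcs_between R (A - R). 0)"
        using h by (intro le_out R(1)) auto
      moreover have "(\<Sum>v \<in> R. net_out h v) = 2"
        by (rule out_R[OF R]) (rule net_h)
      ultimately show False
        by simp
    qed
  qed (use that in blast)
  define \<psi>\<^sub>0 where "\<psi>\<^sub>0 e = 2 * r e - h e" for e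
  have \<psi>\<^sub>0: "\<bar>\<psi>\<^sub>0 e\<bar> = \<bar>h e\<bar>" for e
    using r(1)[of e] by (cases "r e = 0") (auto simp: \<psi>\<^sub>0_def)
  have net_\<psi>\<^sub>0: "net_out \<psi>\<^sub>0 v = 0" for v
    unfolding \<psi>\<^sub>0_def[abs_def] net_out_diff net_out_cmult net_h r by simp
  \<comment> \<open>Connectedness inside the support of \<open>h\<close>, phrased by integer flows
    of any size: only the support of such a flow matters for repairing demands.\<close>
  define joined where "joined v \<longleftrightarrow> (\<exists>f. (\<forall>e. f e \<noteq> 0 \<longrightarrow> h e \<noteq> 0) \<and> (\<forall>w. net_out f w = from_to x v w))" for v
  define K where "K = {v \<in> A. joined v}"
  have joined_arc: "joined w"
    if "joined u" "e \<in> arcs G" "h e \<noteq> 0" "s = 1 \<and> u = tail G e \<and> w = head G e \<or> s = -1 \<and> u = head G e \<and> w = tail G e"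
    for u w e and s :: int
  proof -
    obtain f where f: "\<And>e. f e \<noteq> 0 \<Longrightarrow> h e \<noteq> 0" "\<And>v. net_out f v = from_to x u v"
      using \<open>joined u\<close> unfolding joined_def by blast
    have "net_out (\<lambda>e'. f e' + (if e' = e then s else 0)) v = from_to x w v" for v
      unfolding net_out_add f(2) net_out_unit[OF that(2)] using that(4) by (auto simp: from_to_def)
    moreover have "h e' \<noteq> 0" if "f e' + (if e' = e then s else 0) \<noteq> 0" for e'
      using that f(1)[of e'] \<open>h e \<noteq> 0\<close> by (cases "e' = e") simp_all
    ultimately show ?thesis
      unfolding joined_def
      by (intro exI[of _ "\<lambda>e'. f e' + (if e' = e then s else 0)"] conjI allI impI) blast+
  qed
  have closed: "tail G e \<in> K \<longleftrightarrow> head G e \<in> K" if "e \<in> arcs G" "h e \<noteq> 0" for e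
  proof -
    have "tail G e \<in> A" "head G e \<in> A"
      using h[OF that(2)] by (auto simp: arcs_within_def)
    moreover have "joined (head G e)" if "joined (tail G e)"
      by (rule joined_arc[OF that \<open>e \<in> arcs G\<close> \<open>h e \<noteq> 0\<close>, of 1]) simp
    moreover have "joined (tail G e)" if "joined (head G e)"
      by (rule joined_arc[OF that \<open>e \<in> arcs G\<close> \<open>h e \<noteq> 0\<close>, of "-1"]) simp
    ultimately show ?thesis
      by (auto simp: K_def)
  qed
  define \<psi> where "\<psi> e = (if e \<in> arcs_within K then \<psi>\<^sub>0 e else 0)" for e
  have "x \<in> K"
    using xy unfolding K_def joined_def by (auto simp: from_to_def intro!: exI[of _ "\<lambda>_. 0"])
  moreover have "y \<in> K"
  proof -
    have "h e \<noteq> 0" if "r e \<noteq> 0" for e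
      using r(1)[OF that] that by simp
    then show ?thesis
      using xy r(2) unfolding K_def joined_def by blast
  qed
  moreover have "nice K \<psi>"
  proof (rule nice_if_connected_support)
    show "K \<subseteq> verts G"
      using A by (auto simp: K_def)
    show "x \<in> K" by fact
    show "e \<in> arcs_within K \<and> \<bar>\<psi> e\<bar> = 1" if "\<psi> e \<noteq> 0" for e
      using that h[of e] \<psi>\<^sub>0[of e] by (auto simp: \<psi>_def split: if_splits)
    show "net_out \<psi> v = 0" for v
    proof -
      have "tail G e \<in> K \<longleftrightarrow> head G e \<in> K" if "e \<in> arcs G" "\<psi>\<^sub>0 e \<noteq> 0" for e
        using closed[OF that(1)] \<psi>\<^sub>0[of e] that(2) by auto
      then show ?thesis
        unfolding \<psi>_def[abs_def] by (subst net_out_restrict) (simp_all add: net_\<psi>\<^sub>0)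
    qed
  next
    fix v assume "v \<in> K"
    then obtain f where f: "\<And>e. f e \<noteq> 0 \<Longrightarrow> h e \<noteq> 0" "\<And>w. net_out f w = from_to x v w"
      by (auto simp: K_def joined_def)
    \<comment> \<open>\<open>f\<close> may also run through other components of the support.
      Dropping these parts changes no net outflow on \<open>K\<close>, and both \<open>x\<close> and
      \<open>v\<close> lie in \<open>K\<close>.\<close>
    have "net_out (\<lambda>e. if e \<in> arcs_within K then f e else 0) w = (if w \<in> K then net_out f w else 0)" for w
      by (rule net_out_restrict) (use closed f(1) in blast)
    then have "net_out (\<lambda>e. if e \<in> arcs_within K then f e else 0) w = from_to x v w" for w
      using \<open>x \<in> K\<close> \<open>v \<in> K\<close> unfolding f(2) by (auto simp: from_to_def)
    moreover have "\<psi> e \<noteq> 0" if "(if e \<in> arcs_within K then f e else 0) \<noteq> 0" for e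
      using that f(1)[of e] \<psi>\<^sub>0[of e] by (auto simp: \<psi>_def split: if_splits)
    ultimately show "\<exists>q. (\<forall>e. q e \<noteq> 0 \<longrightarrow> \<psi> e \<noteq> 0) \<and> (\<forall>w. net_out q w = from_to x v w)"
      by (intro exI[of _ "\<lambda>e. if e \<in> arcs_within K then f e else 0"]) blast
  qed
  ultimately show ?thesis
    using that[of K \<psi>] by (auto simp: K_def)
qed

section \<open>Edge cuts and edge-connectivity\<close>

lemma arcs_between_commute: "arcs_between S T = arcs_between T S"
  by (auto simp: arcs_between_def)

lemma edge_connected_card_verts: "edge_connected k G \<Longrightarrow> card (verts G) > 1"
  unfolding edge_connected_def by (rule conjunct1)

text \<open>Deleting a cut of fewer than \<open>k\<close> arcs would leave the graph connected, yet
  no undirected walk starting in \<open>S\<close> could then leave \<open>S\<close>.\<close>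

lemma edge_connected_cut:
  assumes "edge_connected k G" "S \<subset> verts G" "S \<noteq> {}"
  shows "card (arcs_between S (verts G - S)) \<ge> k"
proof (rule ccontr)
  define F where "F = arcs_between S (verts G - S)"
  define H where "H = mk_symmetric (del_arcs G F)"
  assume "\<not> ?thesis"
  then have "Digraph_Component.connected (del_arcs G F)"
    using assms(1) by (auto simp: edge_connected_def F_def arcs_between_def)
  then have conn: "u \<rightarrow>\<^sup>*\<^bsub>with_proj H\<^esub> v" if "u \<in> verts G" "v \<in> verts G" for u v
    using that by (auto simp: H_def connected_def strongly_connected_def del_arcs_def)
  obtain u v where uv: "u \<in> S" "v \<in> verts G" "v \<notin> S"
    using assms by blast
  then have "(u, v) \<in> (arcs_ends (with_proj H))\<^sup>*"
    using conn[of u v] assms(2) unfolding reachable_def by (blast intro: rtrancl_on_rtranclI)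
  then have "v \<in> S"
  proof induction
    case (step y z)
    then obtain e where e: "e \<in> arcs G - F" "(y, z) = (tail G e, head G e) \<or> (y, z) = (head G e, tail G e)"
      by (auto simp: H_def parcs_mk_symmetric del_arcs_def)
    then have "tail G e \<in> verts G" "head G e \<in> verts G"
      by auto
    then show ?case
      using e \<open>y \<in> S\<close> by (auto simp: F_def arcs_between_def)
  qed (rule uv)
  then show False
    using uv by simp
qed

lemma card_cut_split:
  assumes "B \<inter> C = {}" "D \<inter> C = {}" "B \<inter> D = {}"
  shows "card (arcs_between B (C \<union> D)) = card (arcs_between B C) + card (arcs_between B D)"
proof -
  have "arcs_between B (C \<union> D) = arcs_between B C \<union> arcs_between B D"
    by (auto simp: arcs_between_def)
  moreover have "arcs_between B C \<inter> arcs_between B D = {}"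
    using assms by (auto simp: arcs_between_def)
  ultimately show ?thesis
    by (simp add: card_Un_disjoint)
qed

text \<open>
  For a smallest such \<open>A\<close>, one of \<open>B\<close> and \<open>A - B\<close> sends no arc to \<open>W - A\<close>; by minimality at least two
  arcs leave it inside \<open>W\<close>, and these all go to the other part.
\<close>

lemma leaf_part_exists:
  assumes "W \<subseteq> verts G" "W \<noteq> {}"
  obtains A where "A \<subseteq> W" "A \<noteq> {}" "card (arcs_between A (W - A)) \<le> 1"
    "\<And>B. B \<subset> A \<Longrightarrow> B \<noteq> {} \<Longrightarrow> card (arcs_between B (A - B)) \<ge> 2"
proof -
  define P where "P A \<longleftrightarrow> A \<subseteq> W \<and> A \<noteq> {} \<and> card (arcs_between A (W - A)) \<le> 1" for A
  have "arcs_between W (W - W) = {}"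
    by (auto simp: arcs_between_def)
  \<comment> \<open>No arc joins \<open>W\<close> to the empty set, so \<open>W\<close> itself
    qualifies and a smallest candidate exists.\<close>
  then have "P W"
    using assms by (simp add: P_def)
  then obtain A where A: "P A" and least: "\<And>B. P B \<Longrightarrow> card A \<le> card B"
    using ex_has_least_nat[of P W card] by blast
  have "card (arcs_between B (A - B)) \<ge> 2" if B: "B \<subset> A" "B \<noteq> {}" for B
  proof (rule ccontr)
    assume small: "\<not> ?thesis"
    have A': "A \<subseteq> W" "finite A"
      using A assms(1) finite_subset[OF _ finite_verts, of A] unfolding P_def by auto
    have not_P: "\<not> P C" if "C \<subset> A" for C
      using least[of C] psubset_card_mono[OF A'(2) that] by auto
    have "2 \<le> card (arcs_between C (W - C))" if "C \<subset> A" "C \<noteq> {}" for C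
      using not_P[OF that(1)] that A' by (auto simp: P_def)
    from this[of B] this[of "A - B"]
    have 1: "2 \<le> card (arcs_between B (W - B))" and 2: "2 \<le> card (arcs_between (A - B) (W - (A - B)))"
      using B by auto
    have W_eq: "W - B = (A - B) \<union> (W - A)" "W - (A - B) = B \<union> (W - A)" and A_eq: "B \<union> (A - B) = A"
      using A' B by auto
    have 3: "card (arcs_between B (W - B)) = card (arcs_between B (A - B)) + card (arcs_between B (W - A))"
      unfolding W_eq by (rule card_cut_split) (use B in auto)
    have 4: "card (arcs_between (A - B) (W - (A - B))) =
        card (arcs_between (A - B) B) + card (arcs_between (A - B) (W - A))"
      unfolding W_eq by (rule card_cut_split) (use B in auto)
    have "card (arcs_between (W - A) (B \<union> (A - B))) =
        card (arcs_between (W - A) B) + card (arcs_between (W - A) (A - B))"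
      by (rule card_cut_split) (use B in auto)
    then have 5: "card (arcs_between A (W - A)) =
        card (arcs_between B (W - A)) + card (arcs_between (A - B) (W - A))"
      unfolding A_eq by (simp only: arcs_between_commute)
    have 6: "card (arcs_between A (W - A)) \<le> 1"
      using A by (simp add: P_def)
    show False
      using 1 2 small unfolding 3 4 arcs_between_commute[of "A - B" B] using 5 6 by linarith
  qed
  then show ?thesis
    using A by (intro that[of A]) (simp_all add: P_def)
qed

section \<open>Growing the set until it contains all vertices\<close>

text \<open>At least three arcs leave the leaf part \<open>A\<close>, and at most one of them stays
  outside \<open>U\<close>, so two lead to \<open>U\<close>. A nice \<open>K\<close> in
  \<open>A\<close> through their ends can be merged with \<open>U\<close>; the rest of
  \<open>A\<close> is left for later rounds.\<close>

lemma nice_extend: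
  assumes conn: "edge_connected 3 G" and U: "nice U \<psi>" "U \<noteq> {}" "U \<noteq> verts G"
  obtains U' \<psi>' where "nice U' \<psi>'" "U \<subset> U'"
proof -
  define W where "W = verts G - U"
  have UV: "U \<subseteq> verts G"
    using U(1) by (rule niceD)
  then have "W \<subseteq> verts G" "W \<noteq> {}"
    using U(3) by (auto simp: W_def)
  then obtain A where A: "A \<subseteq> W" "A \<noteq> {}" "card (arcs_between A (W - A)) \<le> 1"
    "\<And>B. B \<subset> A \<Longrightarrow> B \<noteq> {} \<Longrightarrow> card (arcs_between B (A - B)) \<ge> 2"
    using leaf_part_exists[of W] by blast
  have AV: "A \<subseteq> verts G" and disj: "U \<inter> A = {}"
    using A(1) by (auto simp: W_def)
  have "verts G - A = U \<union> (W - A)"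
    using UV disj by (auto simp: W_def)
  then have "card (arcs_between A (verts G - A)) = card (arcs_between A U) + card (arcs_between A (W - A))"
    using disj by (auto simp: W_def intro!: card_cut_split)
  moreover have "card (arcs_between A (verts G - A)) \<ge> 3"
    using AV disj U(2) UV A(2) by (intro edge_connected_cut[OF conn]) auto
  ultimately have two: "card (arcs_between A U) \<ge> 2"
    using A(3) by simp
  obtain f where f: "f \<in> arcs_between A U"
    using two by (metis card.empty ex_in_conv not_numeral_le_zero)
  have "card (arcs_between A U - {f}) \<noteq> 0"
    using two f by simp
  then obtain g where g: "g \<in> arcs_between A U" "g \<noteq> f"
    by (metis Diff_iff card.empty ex_in_conv insertI1)
  \<comment> \<open>Only the end in \<open>A\<close> matters: the arc joins \<open>U\<close> to
    every set containing that end, in particular to the \<open>K\<close> chosen below.\<close>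
  have ends: "\<exists>x \<in> A. \<forall>K. x \<in> K \<longrightarrow> e \<in> arcs_between U K" if "e \<in> arcs_between A U" for e
    using that by (auto simp: arcs_between_def)
  obtain x where x: "x \<in> A" "\<And>K. x \<in> K \<Longrightarrow> f \<in> arcs_between U K"
    using ends[OF f] by blast
  obtain y where y: "y \<in> A" "\<And>K. y \<in> K \<Longrightarrow> g \<in> arcs_between U K"
    using ends[OF g(1)] by blast
  obtain K \<psi>' where K: "K \<subseteq> A" "x \<in> K" "y \<in> K" "nice K \<psi>'"
    by (rule nice_subset_through_two_vertices[OF AV x(1) y(1) A(4)])
  have "card {f, g} \<le> card (arcs_between U K)"
    using x(2)[OF K(2)] y(2)[OF K(3)] by (intro card_mono) auto
  then have "card (arcs_between U K) \<ge> 2"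
    using g by simp
  then have "nice (U \<union> K) (\<lambda>e. \<psi> e + \<psi>' e)"
    using U(1) K disj by (intro nice_merge) auto
  moreover have "U \<subset> U \<union> K"
    using K disj by auto
  ultimately show ?thesis
    by (rule that)
qed

lemma nice_verts_exists:
  assumes "edge_connected 3 G"
  obtains \<psi> where "nice (verts G) \<psi>"
proof -
  \<comment> \<open>Nonemptiness is built in because the extension step needs arcs leading to
    \<open>U\<close>; the start is a single vertex.\<close>
  define P where "P U \<longleftrightarrow> U \<noteq> {} \<and> (\<exists>\<psi>. nice U \<psi>)" for U
  have PV: "U \<subseteq> verts G" if "P U" for U
    using that niceD(1) unfolding P_def by blast
  obtain v where "v \<in> verts G"
    using edge_connected_card_verts[OF assms] by fastforce
  then have "P {v}"
    using nice_singleton unfolding P_def by blast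
  have "\<exists>U. P U \<and> (\<forall>U'. P U' \<longrightarrow> card U' \<le> card U)"
    by (rule ex_has_greatest_nat[of P, OF \<open>P {v}\<close>, of card "card (verts G) + 1"])
      (use PV in \<open>auto simp: card_mono le_imp_less_Suc\<close>)
  then obtain U \<psi> where U: "U \<noteq> {}" "nice U \<psi>" and max: "\<And>U'. P U' \<Longrightarrow> card U' \<le> card U"
    unfolding P_def by blast
  have "U = verts G"
  proof (rule ccontr)
    assume "U \<noteq> verts G"
    then obtain U' \<psi>' where U': "nice U' \<psi>'" "U \<subset> U'"
      using nice_extend[OF assms U(2,1)] by blast
    then have "P U'"
      unfolding P_def by blast
    moreover from this have "finite U'"
      using PV finite_verts finite_subset by blast
    ultimately show False
      using max[of U'] psubset_card_mono[OF _ U'(2)] by simp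
  qed
  then show ?thesis
    using U that by blast
qed

subsection \<open>Counting\<close>

lemma net_out_cong: "(\<And>e. e \<in> arcs G \<Longrightarrow> f e = g e) \<Longrightarrow> net_out f v = net_out g v"
  unfolding net_out_eq by (rule sum.cong) auto

lemma in_flows_iff:
  "\<phi> \<in> flows G \<longleftrightarrow> \<phi> \<in> arcs G \<rightarrow>\<^sub>E UNIV \<and> (\<forall>v \<in> verts G. net_out \<phi> v = 0)"
  by (simp add: flows_def net_out_def)

lemma finite_flows: "finite (flows G :: ('b \<Rightarrow> 'g :: {ab_group_add, finite}) set)"
  by (rule finite_subset[of _ "arcs G \<rightarrow>\<^sub>E UNIV"]) (auto simp: flows_def intro: finite_PiE)

text \<open>
  The arcs outside \<open>Z\<close> carry \<open>CARD('g) ^ card (arcs G - Z)\<close> assignments, but the net outflows only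
  take \<open>CARD('g) ^ (card (verts G) - 1)\<close> values; two assignments with the same net outflow differ
  by a flow vanishing on \<open>Z\<close>, which can be added to \<open>\<phi>\<^sub>0\<close>.
\<close>

lemma card_flows_agreeing:
  fixes \<phi>\<^sub>0 :: "'b \<Rightarrow> 'g :: {ab_group_add, finite}"
  assumes \<phi>\<^sub>0: "\<phi>\<^sub>0 \<in> flows G" and "verts G \<noteq> {}"
  shows "CARD('g) ^ card (arcs G - Z) \<le>
    card {\<phi> \<in> flows G. \<forall>e \<in> Z. \<phi> e = \<phi>\<^sub>0 e} * CARD('g) ^ (card (verts G) - 1)"
proof -
  obtain v\<^sub>0 where v\<^sub>0: "v\<^sub>0 \<in> verts G"
    using assms(2) by blast
  \<comment> \<open>One vertex is dropped because net outflows sum to 0, so the value at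
    \<open>v\<^sub>0\<close> is determined by the others. This is the source of the exponent
    \<open>card (verts G) - 1\<close>.\<close>
  define V where "V = verts G - {v\<^sub>0}"
  define P where "P = (arcs G - Z) \<rightarrow>\<^sub>E (UNIV :: 'g set)"
  define B where "B = V \<rightarrow>\<^sub>E (UNIV :: 'g set)"
  define S where "S = {\<phi> \<in> flows G. \<forall>e \<in> Z. \<phi> e = \<phi>\<^sub>0 e}"
  \<comment> \<open>Extension by 0 makes the difference of two assignments vanish on
    \<open>Z\<close>, so adding it to \<open>\<phi>\<^sub>0\<close> keeps the prescribed values
    there.\<close>
  define ext where "ext f e = (if e \<in> arcs G - Z then f e else 0)" for f :: "'b \<Rightarrow> 'g" and e
  define D where "D f = restrict (net_out (ext f)) V" for f
  have fin: "finite P" "finite B" "finite S"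
    using finite_flows by (auto simp: P_def B_def V_def S_def intro!: finite_PiE)
  have fibre: "card {f \<in> P. D f = b} \<le> card S" for b
  proof (cases "{f \<in> P. D f = b} = {}")
    case False
    then obtain f\<^sub>0 where f\<^sub>0: "f\<^sub>0 \<in> P" "D f\<^sub>0 = b"
      by blast
    define F where "F f = restrict (\<lambda>e. \<phi>\<^sub>0 e + (ext f e - ext f\<^sub>0 e)) (arcs G)" for f
    have F: "F f \<in> S" if f: "f \<in> P" "D f = b" for f
    proof -
      have eq: "net_out (ext f) v = net_out (ext f\<^sub>0) v" if "v \<in> V" for v
      proof -
        have "D f v = D f\<^sub>0 v"
          using f f\<^sub>0 by simp
        then show ?thesis
          using that by (simp add: D_def)
      qed
      have at_v\<^sub>0: "net_out (ext f) v\<^sub>0 = - (\<Sum>v \<in> V. net_out (ext f) v)" for f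
        using sum_net_out_verts[of "ext f"] sum.remove[OF finite_verts v\<^sub>0, of "net_out (ext f)"]
        by (simp add: V_def eq_neg_iff_add_eq_0)
      have "(\<Sum>v \<in> V. net_out (ext f) v) = (\<Sum>v \<in> V. net_out (ext f\<^sub>0) v)"
        by (rule sum.cong) (simp_all only: eq)
      then have "net_out (ext f) v\<^sub>0 = net_out (ext f\<^sub>0) v\<^sub>0"
        by (simp only: at_v\<^sub>0)
      then have "net_out (ext f) v = net_out (ext f\<^sub>0) v" if "v \<in> verts G" for v
        using that eq[of v] unfolding V_def by blast
      moreover have "net_out (F f) v = net_out \<phi>\<^sub>0 v + (net_out (ext f) v - net_out (ext f\<^sub>0) v)" for v
        unfolding net_out_add[symmetric] net_out_diff[symmetric]
        by (rule net_out_cong) (simp add: F_def)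
      ultimately have "net_out (F f) v = 0" if "v \<in> verts G" for v
        using that \<phi>\<^sub>0 by (simp add: in_flows_iff)
      moreover have "F f \<in> arcs G \<rightarrow>\<^sub>E UNIV"
        by (simp add: F_def)
      ultimately have "F f \<in> flows G"
        by (simp add: in_flows_iff)
      moreover have "F f e = \<phi>\<^sub>0 e" if "e \<in> Z" for e
      proof (cases "e \<in> arcs G")
        \<comment> \<open>\<open>Z\<close> may contain elements that are not arcs; both functions
          are \<open>undefined\<close> there.\<close>
        case False
        then show ?thesis
          using PiE_arb[of \<phi>\<^sub>0 "arcs G" "\<lambda>_. UNIV" e] \<phi>\<^sub>0 by (simp add: F_def in_flows_iff)
      qed (use that in \<open>simp add: F_def ext_def\<close>)
      ultimately show ?thesis
        by (simp add: S_def)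
    qed
    have "inj_on F P"
    proof (rule inj_onI)
      fix f g assume fg: "f \<in> P" "g \<in> P" "F f = F g"
      have "f e = g e" if "e \<in> arcs G - Z" for e
        using fun_cong[OF fg(3), of e] that by (simp add: F_def ext_def)
      then show "f = g"
        using fg(1,2) unfolding P_def by (rule PiE_ext[rotated 2])
    qed
    then have "inj_on F {f \<in> P. D f = b}"
      by (rule inj_on_subset) auto
    then show ?thesis
      using F fin by (intro card_inj_on_le[of F]) auto
  next
    case True
    then show ?thesis
      by (simp only: card.empty)
  qed
  \<comment> \<open>Count the assignments by their net outflow: each of the \<open>card B\<close>
    possible values is taken at most \<open>card S\<close> times.\<close>
  have "card P = (\<Sum>f \<in> P. 1)"
    by simp
  also have "\<dots> = (\<Sum>b \<in> B. \<Sum>f \<in> {f \<in> P. D f = b}. 1)"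
    by (rule sum.group[symmetric]) (use fin in \<open>auto simp: D_def B_def\<close>)
  also have "\<dots> \<le> of_nat (card B) * card S"
    by (rule sum_bounded_above) (use fibre in simp)
  finally have "card P \<le> card S * card B"
    by (simp add: mult.commute)
  moreover have "card V = card (verts G) - 1"
    using v\<^sub>0 by (simp add: V_def)
  ultimately show ?thesis
    by (simp add: P_def B_def S_def card_PiE V_def)
qed

lemma sum_card_fibres:
  assumes "g \<in> {tail G, head G}" "X \<subseteq> arcs G"
  shows "(\<Sum>v \<in> verts G. card {e \<in> X. g e = v}) = card X"
proof -
  have "(\<Sum>v \<in> verts G. \<Sum>e \<in> {e \<in> X. g e = v}. 1 :: nat) = (\<Sum>e \<in> X. 1)"
    by (rule sum.group) (use assms finite_subset[of X "arcs G"] in auto)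
  then show ?thesis
    by simp
qed

end

section \<open>Degrees and the size of the support\<close>

text \<open>Nonzero values are 1 or -1, hence odd, so the sum has the parity of the number of
  nonzero terms.\<close>

lemma even_card_support_iff:
  fixes f :: "'c \<Rightarrow> int"
  assumes "finite A" "\<And>e. e \<in> A \<Longrightarrow> f e \<noteq> 0 \<Longrightarrow> \<bar>f e\<bar> = 1"
  shows "even (card {e \<in> A. f e \<noteq> 0}) \<longleftrightarrow> even (sum f A)"
  using assms
proof (induction A)
  case (insert a A)
  have "even (f a) \<longleftrightarrow> f a = 0"
    using insert.prems[of a] by (cases "f a = 0") (auto simp: abs_if split: if_splits)
  moreover have "{e \<in> insert a A. f e \<noteq> 0} =
      (if f a = 0 then {e \<in> A. f e \<noteq> 0} else insert a {e \<in> A. f e \<noteq> 0})"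
    by auto
  ultimately show ?case
    using insert by simp
qed simp

context fin_digraph
begin

text \<open>Let \<open>d\<close> be the degree of \<open>v\<close> and \<open>dX\<close> its degree
  in the support, loops counted twice. Then \<open>d\<close> is at least 3, and conservation of
  \<open>\<psi>\<close> makes \<open>dX\<close> even. If \<open>d = 3\<close>, then
  \<open>dX\<close> is at most 2; if \<open>d\<close> is at least 4, then \<open>dX \<le> d\<close>
  suffices.\<close>

lemma degree_bound:
  assumes conn: "edge_connected 3 G" and \<psi>: "nice (verts G) \<psi>" and v: "v \<in> verts G"
  shows "card {e \<in> {e \<in> arcs G. \<psi> e \<noteq> 0}. tail G e = v} + card {e \<in> {e \<in> arcs G. \<psi> e \<noteq> 0}. head G e = v} + 7
    \<le> 3 * (card {e \<in> arcs G. tail G e = v} + card {e \<in> arcs G. head G e = v})"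
proof -
  let ?out = "{e \<in> arcs G. tail G e = v}" and ?in = "{e \<in> arcs G. head G e = v}"
  let ?outX = "{e \<in> ?out. \<psi> e \<noteq> 0}" and ?inX = "{e \<in> ?in. \<psi> e \<noteq> 0}"
  have "verts G \<noteq> {v}"
    using edge_connected_card_verts[OF conn] by auto
  then have "3 \<le> card (arcs_between {v} (verts G - {v}))"
    using v by (intro edge_connected_cut[OF conn]) auto
  also have "\<dots> \<le> card (?out \<union> ?in)"
    by (rule card_mono) (auto simp: arcs_between_def)
  also have "\<dots> \<le> card ?out + card ?in"
    by (rule card_Un_le)
  finally have deg: "3 \<le> card ?out + card ?in" .
  have even_iff: "even (card {e \<in> A. \<psi> e \<noteq> 0}) \<longleftrightarrow> even (sum \<psi> A)" if "finite A" for A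
    by (rule even_card_support_iff[OF that]) (use niceD(2)[OF \<psi>] in blast)
  have "even (card ?outX) \<longleftrightarrow> even (sum \<psi> ?out)"
    by (rule even_iff) simp
  moreover have "even (card ?inX) \<longleftrightarrow> even (sum \<psi> ?in)"
    by (rule even_iff) simp
  moreover have "sum \<psi> ?out = sum \<psi> ?in"
    using niceD(3)[OF \<psi>, of v] by (simp add: net_out_def out_arcs_def in_arcs_def)
  ultimately have even: "even (card ?outX + card ?inX)"
    unfolding even_add by (simp only:)
  have "card ?outX \<le> card ?out"
    by (rule card_mono) auto
  moreover have "card ?inX \<le> card ?in"
    by (rule card_mono) auto
  ultimately have le: "card ?outX + card ?inX \<le> card ?out + card ?in"
    by (rule add_mono)
  have "dX + 7 \<le> 3 * d" if "even dX" "dX \<le> d" "3 \<le> d" for dX d :: nat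
  proof (cases "d = 3")
    case True
    then have "dX \<noteq> 3"
      using that by auto
    then show ?thesis
      using that True by linarith
  next
    case False
    then show ?thesis
      using that by linarith
  qed
  from this[OF even le deg]
  have "card ?outX + card ?inX + 7 \<le> 3 * (card ?out + card ?in)" .
  moreover have "{e \<in> {e \<in> arcs G. \<psi> e \<noteq> 0}. tail G e = v} = ?outX"
    "{e \<in> {e \<in> arcs G. \<psi> e \<noteq> 0}. head G e = v} = ?inX"
    by auto
  ultimately show ?thesis
    by (simp only:)
qed

text \<open>Sum the degree bound over all vertices; each arc is counted once at its tail and once at
  its head.\<close>

lemma support_bound:
  assumes "edge_connected 3 G" "nice (verts G) \<psi>"
  shows "2 * card {e \<in> arcs G. \<psi> e \<noteq> 0} + 7 * card (verts G) \<le> 6 * card (arcs G)"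
proof -
  define X where "X = {e \<in> arcs G. \<psi> e \<noteq> 0}"
  have "(\<Sum>v \<in> verts G. card {e \<in> X. tail G e = v} + card {e \<in> X. head G e = v} + 7)
    \<le> (\<Sum>v \<in> verts G. 3 * (card {e \<in> arcs G. tail G e = v} + card {e \<in> arcs G. head G e = v}))"
    unfolding X_def by (intro sum_mono degree_bound assms)
  moreover have "X \<subseteq> arcs G"
    by (auto simp: X_def)
  ultimately have "2 * card X + 7 * card (verts G) \<le> 6 * card (arcs G)"
    by (simp add: sum.distrib sum_card_fibres flip: sum_distrib_left)
  then show ?thesis
    by (simp only: X_def)
qed

section \<open>Choosing the flow modulo 3 and pairing it with flows modulo 2\<close>

lemma seymour_flow_pair:
  assumes "edge_connected 3 G"
  obtains \<psi> :: "'b \<Rightarrow> int" and \<phi> :: "'b \<Rightarrow> 3" where "nice (verts G) \<psi>"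
    "\<And>v. v \<in> verts G \<Longrightarrow> net_out \<phi> v = 0" "\<And>e. e \<in> arcs G \<Longrightarrow> \<psi> e = 0 \<Longrightarrow> \<phi> e \<noteq> 0"
    "3 * card {e \<in> arcs G. \<phi> e = 0} \<le> card {e \<in> arcs G. \<psi> e \<noteq> 0}"
proof -
  obtain \<psi> where \<psi>: "nice (verts G) \<psi>"
    using nice_verts_exists[OF assms] by blast
  have zero: "(\<Sum>v \<in> verts G. 0 :: 3) = 0"
    by simp
  have within: "arcs_within (verts G) = arcs G"
    by (auto simp: arcs_within_def)
  have "\<exists>\<phi> :: 'b \<Rightarrow> 3. (\<forall>v \<in> verts G. net_out \<phi> v = 0) \<and> (\<forall>e \<in> arcs G. \<psi> e = 0 \<longrightarrow> \<phi> e \<noteq> 0)"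
    by (rule nice_realize[OF \<psi> zero, unfolded within]) blast
  then obtain \<phi> :: "'b \<Rightarrow> 3" where \<phi>: "\<forall>v \<in> verts G. net_out \<phi> v = 0"
    "\<forall>e \<in> arcs G. \<psi> e = 0 \<longrightarrow> \<phi> e \<noteq> 0"
    by (elim exE conjE)
  \<comment> \<open>Adding multiples of the circulation \<open>\<psi>\<close> changes neither the
    net outflows nor the values off its support.\<close>
  define \<phi>' where "\<phi>' j e = \<phi> e + j * of_int (\<psi> e)" for j :: 3 and e
  define X where "X = {e \<in> arcs G. \<psi> e \<noteq> 0}"
  define Z where "Z j = {e \<in> arcs G. \<phi>' j e = 0}" for j
  have "finite X" "\<And>j. finite (Z j)"
    by (auto simp: X_def Z_def)
  have nz: "\<phi>' j e \<noteq> 0" if "e \<in> arcs G" "\<psi> e = 0" for j e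
    using \<phi>(2) that by (simp add: \<phi>'_def)
  have unit: "\<psi> e = 1 \<or> \<psi> e = -1" if "\<psi> e \<noteq> 0" for e
    using niceD(2)[OF \<psi> that] by auto
  \<comment> \<open>On the support \<open>\<psi>\<close> takes the invertible values 1 and -1, so at
    most one multiple can cancel \<open>\<phi>\<close> at a given arc. The smallest of the three
    disjoint zero sets has at most a third of the support.\<close>
  have "Z j \<inter> Z k = {}" if "j \<noteq> k" for j k
  proof -
    have "j = k" if e: "e \<in> arcs G" "\<phi>' j e = 0" "\<phi>' k e = 0" for e
    proof -
      have "j * of_int (\<psi> e) = k * of_int (\<psi> e)"
        using e(2,3) unfolding \<phi>'_def by (metis add_left_cancel)
      moreover have "\<psi> e \<noteq> 0"
        using nz e by blast
      ultimately show ?thesis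
        using unit[of e] by auto
    qed
    then show ?thesis
      using that by (auto simp: Z_def)
  qed
  then have "(\<Sum>j \<in> UNIV. card (Z j)) = card (\<Union>j. Z j)"
    using \<open>\<And>j. finite (Z j)\<close> by (simp add: card_UN_disjoint)
  also have "\<dots> \<le> card X"
    by (rule card_mono) (use nz \<open>finite X\<close> in \<open>auto simp: Z_def X_def\<close>)
  finally have sum: "(\<Sum>j \<in> UNIV. card (Z j)) \<le> card X" .
  have "\<exists>j. 3 * card (Z j) \<le> card X"
  proof (rule ccontr)
    assume "\<not> ?thesis"
    then have "card X < 3 * card (Z j)" for j
      by (simp add: not_le)
    then have "(\<Sum>j \<in> (UNIV :: 3 set). card X) < (\<Sum>j \<in> UNIV. 3 * card (Z j))"
      by (intro sum_strict_mono) auto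
    then have "3 * card X < 3 * (\<Sum>j \<in> UNIV. card (Z j))"
      unfolding sum_distrib_left by simp
    then show False
      using sum by simp
  qed
  then obtain j where j: "3 * card (Z j) \<le> card X"
    by blast
  have "net_out (\<phi>' j) v = 0" if "v \<in> verts G" for v
    unfolding \<phi>'_def[abs_def] net_out_add net_out_cmult net_out_of_int niceD(3)[OF \<psi>]
    using \<phi>(1) that by simp
  then show ?thesis
    by (rule that[OF \<psi> _ nz j[unfolded Z_def X_def]])
qed

text \<open>A pair is nonzero as soon as one coordinate is, so \<open>f\<close> only has to be
  nonzero at the zeros of \<open>\<phi>\<close>. With \<open>\<phi>\<close> fixed, different
  \<open>f\<close> give different pairs.\<close>

lemma nowhere_zero_pair_count:
  fixes \<phi> :: "'b \<Rightarrow> 3" and S :: "('b \<Rightarrow> 2) set"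
  assumes S: "S \<subseteq> flows G" and \<phi>: "\<And>v. v \<in> verts G \<Longrightarrow> net_out \<phi> v = 0"
    and nz: "\<And>f e. f \<in> S \<Longrightarrow> e \<in> arcs G \<Longrightarrow> \<phi> e = 0 \<Longrightarrow> f e \<noteq> 0"
  shows "card S \<le> card (nowhere_zero_flows G :: ('b \<Rightarrow> 2 \<times> 3) set)"
proof (rule card_inj_on_le)
  let ?F = "\<lambda>f :: 'b \<Rightarrow> 2. restrict (\<lambda>e. (f e, \<phi> e)) (arcs G)"
  show "inj_on ?F S"
  proof (rule inj_onI)
    fix f g assume fg: "f \<in> S" "g \<in> S" "?F f = ?F g"
    have "f e = g e" if "e \<in> arcs G" for e
      using fun_cong[OF fg(3), of e] that by simp
    then show "f = g"
      using fg S by (intro PiE_ext[of f "arcs G" "\<lambda>_. UNIV" g]) (auto simp: flows_def)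
  qed
  show "?F ` S \<subseteq> (nowhere_zero_flows G :: ('b \<Rightarrow> 2 \<times> 3) set)"
  proof (rule image_subsetI)
    fix f assume f: "f \<in> S"
    have "net_out (?F f) v = (net_out f v, net_out \<phi> v)" for v
    proof -
      have "net_out (?F f) v = net_out (\<lambda>e. (f e, \<phi> e)) v"
        by (rule net_out_cong) simp
      then show ?thesis
        by (simp add: net_out_def sum_prod)
    qed
    then have "?F f \<in> flows G"
      using f S \<phi> by (auto simp: in_flows_iff zero_prod_def)
    moreover have "?F f e \<noteq> 0" if "e \<in> arcs G" for e
      using nz[OF f that] that by (auto simp: zero_prod_def)
    ultimately show "?F f \<in> nowhere_zero_flows G"
      unfolding nowhere_zero_flows_def by blast
  qed
  show "finite (nowhere_zero_flows G :: ('b \<Rightarrow> 2 \<times> 3) set)"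
    by (rule finite_subset[OF _ finite_flows]) (auto simp: nowhere_zero_flows_def)
qed

end

section \<open>The lower bound on the number of nowhere-zero flows\<close>

theorem theorem13:
  fixes G :: "('a, 'b) pre_digraph"
  assumes "fin_digraph G"
    and "edge_connected 3 G"
    and "card (verts G) = n"
  shows "real (card (nowhere_zero_flows G :: ('b \<Rightarrow> 2 \<times> 3) set)) \<ge> 2 powr (real n / 7)"
proof -
  interpret fin_digraph G by fact
  obtain \<psi> :: "'b \<Rightarrow> int" and \<phi> :: "'b \<Rightarrow> 3" where \<psi>: "nice (verts G) \<psi>"
    and \<phi>: "\<And>v. v \<in> verts G \<Longrightarrow> net_out \<phi> v = 0" "\<And>e. e \<in> arcs G \<Longrightarrow> \<psi> e = 0 \<Longrightarrow> \<phi> e \<noteq> 0"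
    and Z_le: "3 * card {e \<in> arcs G. \<phi> e = 0} \<le> card {e \<in> arcs G. \<psi> e \<noteq> 0}"
    using seymour_flow_pair[OF assms(2)] by blast
  define Z where "Z = {e \<in> arcs G. \<phi> e = 0}"
  \<comment> \<open>Modulo 2 both 1 and -1 become 1, so this flow is nonzero on the whole support of
    \<open>\<psi>\<close>, which contains \<open>Z\<close>.\<close>
  define \<phi>\<^sub>0 :: "'b \<Rightarrow> 2" where "\<phi>\<^sub>0 = restrict (\<lambda>e. of_int (\<psi> e)) (arcs G)"
  define S where "S = {f \<in> flows G. \<forall>e \<in> Z. f e = \<phi>\<^sub>0 e}"
  have "net_out \<phi>\<^sub>0 v = net_out (\<lambda>e. of_int (\<psi> e)) v" for v
    by (rule net_out_cong) (simp add: \<phi>\<^sub>0_def)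
  then have "\<phi>\<^sub>0 \<in> flows G"
    using niceD(3)[OF \<psi>] by (simp add: in_flows_iff net_out_of_int) (simp add: \<phi>\<^sub>0_def)
  moreover have "verts G \<noteq> {}"
    using edge_connected_card_verts[OF assms(2)] by auto
  ultimately have count: "2 ^ card (arcs G - Z) \<le> card S * 2 ^ (n - 1)"
    using card_flows_agreeing[of \<phi>\<^sub>0 Z] assms(3) by (simp add: S_def)
  have "\<phi>\<^sub>0 e \<noteq> 0" if "e \<in> Z" for e
  proof -
    have "e \<in> arcs G" "\<psi> e \<noteq> 0"
      using that \<phi>(2) by (auto simp: Z_def)
    moreover from this have "\<psi> e = 1 \<or> \<psi> e = -1"
      using niceD(2)[OF \<psi>, of e] by auto
    ultimately show ?thesis
      by (auto simp: \<phi>\<^sub>0_def)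
  qed
  then have "card S \<le> card (nowhere_zero_flows G :: ('b \<Rightarrow> 2 \<times> 3) set)" (is "_ \<le> ?N")
    using \<phi>(1) by (intro nowhere_zero_pair_count[of S \<phi>]) (auto simp: S_def Z_def)
  with count have "2 ^ card (arcs G - Z) \<le> ?N * 2 ^ (n - 1)"
    by (meson le_trans mult_le_mono1)
  then have "real (2 ^ card (arcs G - Z)) \<le> real (?N * 2 ^ (n - 1))"
    by (simp only: of_nat_le_iff)
  then have "2 powr real (card (arcs G - Z)) \<le> real ?N * 2 powr real (n - 1)"
    by (simp add: powr_realpow)
  then have "2 powr (real (card (arcs G - Z)) - real (n - 1)) \<le> real ?N"
    by (simp add: powr_diff pos_divide_le_eq)
  \<comment> \<open>From \<open>6 |E| \<ge> 2 |X| + 7 n\<close> and \<open>|X| \<ge> 3 |Z|\<close>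
    follows \<open>|E| - |Z| \<ge> 7 n / 6\<close>, where \<open>E\<close> is the arc set and
    \<open>X\<close> the support of \<open>\<psi>\<close>. Subtracting at most \<open>n\<close>
    leaves \<open>n / 6\<close>, more than is asked.\<close>
  moreover have "real n / 7 \<le> real (card (arcs G - Z)) - real (n - 1)"
  proof -
    have "card Z \<le> card (arcs G)"
      by (rule card_mono) (auto simp: Z_def)
    then have "real (card (arcs G - Z)) = real (card (arcs G)) - real (card Z)"
      by (simp add: card_Diff_subset Z_def)
    moreover have "real (2 * card {e \<in> arcs G. \<psi> e \<noteq> 0} + 7 * n) \<le> real (6 * card (arcs G))"
      using support_bound[OF assms(2) \<psi>] assms(3) by (simp only: of_nat_le_iff)
    moreover have "real (3 * card Z) \<le> real (card {e \<in> arcs G. \<psi> e \<noteq> 0})"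
      using Z_le by (simp only: of_nat_le_iff Z_def)
    moreover have "real (n - 1) \<le> real n"
      by simp
    ultimately show ?thesis
      by (simp add: field_simps)
  qed
  ultimately show ?thesis
    by (meson order_trans powr_mono one_le_numeral)
qed

end
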